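(* In any countably infinite group $G$ there exists an infinitely divisible subset $A$ which is not equivalent to an absorbing subset of $G$; that is, there is an infinitely divisible $A\subseteq G$ such that no absorbing subset $B\subseteq G$ satisfies $A\approx B$.
   Context: For non-empty $A,B\subseteq G$ write $A\propto B$ if $A\subseteq FB=\bigcup_{g\in F}gB$ for some finite $F\subseteq G$, and $A\approx B$ ("$A$ and $B$ are equivalent") if $A\propto B$ and $B\propto A$. A non-empty $A\subseteq G$ is $n$-divisible if there are pairwise disjoint subsets $A_1,\dots,A_n$ of $A$ with $A_j\approx A$ for all $j$, and infinitely divisible if it is $n$-divisible for all integers $n\ge1$. A non-empty $A\subseteq G$ is absorbing if for every finite subset $F$ of $G$ there exists $g\in G$ with $Fg\subseteq A$. *)

theory Defs
  imports "HOL-Algebra.Coset" "HOL-Library.Countable_Set" "HOL-Library.Disjoint_Sets"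
begin

text \<open>
  The relations below are defined only between non-empty subsets of the group; the guards in
  \<open>set_below\<close> make them false for all other arguments.
\<close>

definition set_below :: "('a, 'b) monoid_scheme \<Rightarrow> 'a set \<Rightarrow> 'a set \<Rightarrow> bool" where
  "set_below G A B \<longleftrightarrow>
     A \<noteq> {} \<and> A \<subseteq> carrier G \<and> B \<noteq> {} \<and> B \<subseteq> carrier G \<and>
     (\<exists>F. finite F \<and> F \<subseteq> carrier G \<and> A \<subseteq> (\<Union>g\<in>F. g <#\<^bsub>G\<^esub> B))"

definition set_equivalent :: "('a, 'b) monoid_scheme \<Rightarrow> 'a set \<Rightarrow> 'a set \<Rightarrow> bool" where
  "set_equivalent G A B \<longleftrightarrow> set_below G A B \<and> set_below G B A"

definition n_divisible :: "('a, 'b) monoid_scheme \<Rightarrow> nat \<Rightarrow> 'a set \<Rightarrow> bool" where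
  "n_divisible G n A \<longleftrightarrow>
     A \<noteq> {} \<and> A \<subseteq> carrier G \<and>
     (\<exists>S. disjoint_family_on S {1..n} \<and> (\<forall>j\<in>{1..n}. S j \<subseteq> A \<and> set_equivalent G (S j) A))"

definition infinitely_divisible :: "('a, 'b) monoid_scheme \<Rightarrow> 'a set \<Rightarrow> bool" where
  "infinitely_divisible G A \<longleftrightarrow> (\<forall>n\<ge>1. n_divisible G n A)"

definition absorbing :: "('a, 'b) monoid_scheme \<Rightarrow> 'a set \<Rightarrow> bool" where
  "absorbing G A \<longleftrightarrow>
     A \<noteq> {} \<and> A \<subseteq> carrier G \<and>
     (\<forall>F. finite F \<and> F \<subseteq> carrier G \<longrightarrow> (\<exists>g\<in>carrier G. F #>\<^bsub>G\<^esub> g \<subseteq> A))"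

end

theory Submission
  imports Defs
begin

text \<open>
  The set \<open>A\<close> consists of all ordered products \<open>g i\<^sub>1 \<otimes> \<dots> \<otimes> g i\<^sub>k\<close> with
  \<open>i\<^sub>1 < \<dots> < i\<^sub>k\<close> of a rapidly growing sequence \<open>g\<close>. Let \<open>P\<^sub>m\<close> be the finite set of products
  of the first \<open>m\<close> terms and \<open>T\<^sub>m\<close> the set of products of the remaining ones. Then \<open>A\<close> is the
  disjoint union of the \<open>2 ^ m\<close> left translates of \<open>T\<^sub>m\<close> by the elements of \<open>P\<^sub>m\<close>, and each
  of them is equivalent to \<open>A\<close>; so \<open>A\<close> is infinitely divisible. On the other hand \<open>g\<close> is chosen
  such that a subset of \<open>A\<close> whose right quotients \<open>x \<otimes> inv y\<close> all lie in a prescribed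
  finite set \<open>U m\<close> lies in a single right translate of \<open>P\<^sub>m\<close> and has at most \<open>2 ^ m\<close> elements.
  If \<open>A\<close> were equivalent to an absorbing set, then some \<open>F A\<close> with \<open>F\<close> finite would contain right
  translates of all finite sets \<open>K\<close>, and \<open>A\<close> would have subsets of size at least \<open>|K| / |F|\<close> whose
  quotients lie in \<open>F\<^sup>-\<^sup>1 K K\<^sup>-\<^sup>1 F\<close>; choosing \<open>U\<close> to contain these sets for large \<open>K\<close> excludes this.
\<close>

section \<open>Ordered products over windows of a sequence\<close>

text \<open>The window consists of the \<open>n\<close> terms starting at \<open>g m\<close>; each
  step decides whether the next term is appended on the right.\<close>

primrec subproducts ::
    "('a, 'b) monoid_scheme \<Rightarrow> (nat \<Rightarrow> 'a) \<Rightarrow> nat \<Rightarrow> nat \<Rightarrow> 'a set" where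
  "subproducts G g m 0 = {\<one>\<^bsub>G\<^esub>}"
| "subproducts G g m (Suc n) =
     subproducts G g m n \<union> (subproducts G g m n #>\<^bsub>G\<^esub> g (m + n))"

lemma subproducts_mono: "k \<le> n \<Longrightarrow> subproducts G g m k \<subseteq> subproducts G g m n"
  by (rule lift_Suc_mono_le[of "subproducts G g m"]) auto

lemma finite_subproducts: "finite (subproducts G g m n)"
  by (induction n) (auto simp: r_coset_def)

lemma one_in_subproducts: "\<one>\<^bsub>G\<^esub> \<in> subproducts G g m n"
  by (induction n) auto

context group
begin

lemma inv_mult_cancel:
  assumes "x \<in> carrier G" "y \<in> carrier G"
  shows "inv x \<otimes> (x \<otimes> y) = y" "x \<otimes> (inv x \<otimes> y) = y"
  using assms by (simp_all add: m_assoc[symmetric])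

lemma subproducts_closed:
  assumes "\<And>i. g i \<in> carrier G"
  shows "subproducts G g m n \<subseteq> carrier G"
  using assms by (induction n) (auto simp: r_coset_def)

lemma subproducts_add:
  assumes "\<And>i. g i \<in> carrier G"
  shows "subproducts G g 0 (m + n) = (\<Union>p\<in>subproducts G g 0 m. p <# subproducts G g m n)"
proof (induction n)
  case 0
  show ?case using subproducts_closed[of g 0 m] assms by (force simp: l_coset_def)
next
  case (Suc n)
  have c: "p \<otimes> (t \<otimes> g (m + n)) = p \<otimes> t \<otimes> g (m + n)"
    if "p \<in> subproducts G g 0 m" "t \<in> subproducts G g m n" for p t
    using that subproducts_closed[of g] assms by (metis m_assoc subsetD)
  have "(\<Union>p\<in>subproducts G g 0 m. p <# (subproducts G g m n #> g (m + n)))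
      = (\<Union>p\<in>subproducts G g 0 m. p <# subproducts G g m n) #> g (m + n)"
    using c by (fastforce simp: l_coset_def r_coset_def)
  moreover have "p <# (S \<union> T) = (p <# S) \<union> (p <# T)" for p S T
    by (auto simp: l_coset_def)
  ultimately show ?case using Suc by (simp add: UN_Un_distrib)
qed

section \<open>Sequences whose products are far apart\<close>

definition separated :: "(nat \<Rightarrow> 'a set) \<Rightarrow> (nat \<Rightarrow> 'a) \<Rightarrow> bool" where
  "separated U g \<longleftrightarrow> (\<forall>n. \<forall>a\<in>subproducts G g 0 n. \<forall>b\<in>subproducts G g 0 n.
     a \<otimes> g n \<otimes> inv b \<notin> U n)"

text \<open>For given \<open>a\<close>, \<open>b\<close> and \<open>u\<close> in \<open>U n\<close>,
  only \<open>inv a \<otimes> u \<otimes> b\<close> is forbidden as a value of \<open>g n\<close>.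
  So each step forbids finitely many elements of an infinite group.\<close>

lemma exists_separated:
  assumes "infinite (carrier G)" and "\<And>n. finite (U n)"
  obtains g where "\<And>i. g i \<in> carrier G" and "separated U g"
proof -
  have ex: "\<exists>x\<in>carrier G. \<forall>a\<in>P. \<forall>b\<in>P. a \<otimes> x \<otimes> inv b \<notin> U n"
    if P: "finite P" "P \<subseteq> carrier G" for P n
  proof -
    have "finite ((\<lambda>(a, u, b). inv a \<otimes> u \<otimes> b) ` (P \<times> U n \<times> P))"
      using P assms by auto
    then obtain x where x: "x \<in> carrier G"
      "x \<notin> (\<lambda>(a, u, b). inv a \<otimes> u \<otimes> b) ` (P \<times> U n \<times> P)"
      using assms(1) by (meson finite_subset subsetI)
    have "a \<otimes> x \<otimes> inv b \<notin> U n" if "a \<in> P" "b \<in> P" for a b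
    proof
      assume u: "a \<otimes> x \<otimes> inv b \<in> U n"
      have "a \<in> carrier G" "b \<in> carrier G" using that P by auto
      then have "x = inv a \<otimes> (a \<otimes> x \<otimes> inv b) \<otimes> b"
        using x by (simp add: m_assoc inv_mult_cancel)
      with x(2) u that show False by force
    qed
    with x(1) show ?thesis by blast
  qed
  \<comment> \<open>The choice depends on the earlier terms only through their set of products, so
    the recursion runs over these sets and \<open>g\<close> is read off afterwards.\<close>
  define pick where "pick n P = (SOME x. x \<in> carrier G \<and>
    (\<forall>a\<in>P. \<forall>b\<in>P. a \<otimes> x \<otimes> inv b \<notin> U n))" for n P
  have pick: "pick n P \<in> carrier G"
    "a \<in> P \<Longrightarrow> b \<in> P \<Longrightarrow> a \<otimes> pick n P \<otimes> inv b \<notin> U n"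
    if "finite P" "P \<subseteq> carrier G" for P n a b
    using someI_ex[OF ex[unfolded Bex_def, OF that]] unfolding pick_def by blast+
  define P where "P = rec_nat {\<one>} (\<lambda>n P. P \<union> (P #> pick n P))"
  define g where "g n = pick n (P n)" for n
  have P_Suc: "P (Suc n) = P n \<union> (P n #> g n)" for n
    by (simp add: P_def g_def)
  have "P n = subproducts G g 0 n" for n
    by (induction n) (simp_all add: P_Suc, simp add: P_def)
  moreover have P: "finite (P n) \<and> P n \<subseteq> carrier G" for n
  proof (induction n)
    case 0
    then show ?case by (simp add: P_def)
  next
    case (Suc n)
    then show ?case using pick(1) by (auto simp: P_Suc g_def r_coset_def)
  qed
  ultimately show thesis
    using pick that[of g] by (simp add: separated_def g_def)
qed

section \<open>Counting products of a separated sequence\<close>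

context
  fixes U :: "nat \<Rightarrow> 'a set" and g :: "nat \<Rightarrow> 'a"
  assumes g: "\<And>i. g i \<in> carrier G" and sep: "separated U g"
    and one_U: "\<And>n. \<one> \<in> U n" and mono_U: "mono U"
begin

abbreviation "P \<equiv> subproducts G g 0"

lemma P_closed: "x \<in> P n \<Longrightarrow> x \<in> carrier G"
  using subproducts_closed[of g] g by blast

lemma separatedD:
  assumes "a \<in> P n" "b \<in> P n" "k \<le> n"
  shows "a \<otimes> g n \<otimes> inv b \<notin> U k"
  using assms sep mono_U unfolding separated_def by (meson monoD subsetD)

lemma mult_g_neq:
  assumes "a \<in> P n" "b \<in> P n"
  shows "a \<otimes> g n \<noteq> b"
  using separatedD[OF assms order_refl] one_U P_closed[OF assms(2)] by force

lemma card_subproducts: "card (P n) = 2 ^ n"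
proof (induction n)
  case (Suc n)
  have "inj_on (\<lambda>x. x \<otimes> g n) (P n)"
    using P_closed g by (auto intro!: inj_onI)
  moreover have "P n #> g n = (\<lambda>x. x \<otimes> g n) ` P n"
    by (auto simp: r_coset_def)
  moreover have "P n \<inter> (P n #> g n) = {}"
    using mult_g_neq by (force simp: r_coset_def)
  ultimately show ?case
    using Suc by (simp add: card_Un_disjoint finite_subproducts card_image)
qed auto

text \<open>For \<open>n \<ge> m\<close>, separation forces all elements of \<open>X\<close> or none
  to end in \<open>g n\<close>. Cancelling a common last factor keeps the quotients, so one descends
  to \<open>P m\<close>, which has \<open>2 ^ m\<close> elements.\<close>

lemma card_le_if_quotients:
  assumes "X \<subseteq> P n" and "\<And>x y. x \<in> X \<Longrightarrow> y \<in> X \<Longrightarrow> x \<otimes> inv y \<in> U m"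
  shows "card X \<le> 2 ^ m"
  using assms
proof (induction n arbitrary: X)
  case 0
  then have "card X \<le> card {\<one>}" by (intro card_mono) auto
  also have "\<dots> \<le> 2 ^ m" by simp
  finally show ?case .
next
  case (Suc n)
  consider "Suc n \<le> m" | "m \<le> n" "X \<subseteq> P n" | "m \<le> n" "\<not> X \<subseteq> P n" by linarith
  then show ?case
  proof cases
    case 1
    have "card X \<le> card (P (Suc n))"
      using Suc.prems(1) finite_subproducts by (intro card_mono)
    also have "\<dots> = 2 ^ Suc n" by (rule card_subproducts)
    also have "\<dots> \<le> 2 ^ m" using 1 by (intro power_increasing) auto
    finally show ?thesis .
  next
    case 2
    then show ?thesis using Suc by blast
  next
    case 3
    then obtain x where x: "x \<in> X" "x \<notin> P n" by blast
    with Suc.prems(1) obtain a where a: "a \<in> P n" "x = a \<otimes> g n"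
      by (auto simp: r_coset_def)
    \<comment> \<open>Otherwise \<open>x \<otimes> inv y\<close> would lie in \<open>U m\<close>,
      which separation at index \<open>n \<ge> m\<close> forbids.\<close>
    have "y \<notin> P n" if "y \<in> X" for y
      using separatedD[OF a(1) _ 3(1), of y] Suc.prems(2)[OF x(1) that] a(2) by blast
    then have X: "\<exists>b\<in>P n. y = b \<otimes> g n" if "y \<in> X" for y
      using that Suc.prems(1) by (auto simp: r_coset_def)
    define Y where "Y = (\<lambda>y. y \<otimes> inv g n) ` X"
    have "Y \<subseteq> P n"
    proof
      fix z assume "z \<in> Y"
      then obtain b where "b \<in> P n" "z = b \<otimes> g n \<otimes> inv g n" using X by (auto simp: Y_def)
      then show "z \<in> P n" using P_closed[of b n] g by (simp add: m_assoc)
    qed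
    moreover have "u \<otimes> inv v \<in> U m" if uv: "u \<in> Y" "v \<in> Y" for u v
    proof -
      from uv obtain x y where xy: "x \<in> X" "y \<in> X" "u = x \<otimes> inv g n" "v = y \<otimes> inv g n"
        by (auto simp: Y_def)
      have c: "x \<in> carrier G" "y \<in> carrier G"
        using xy Suc.prems(1) P_closed by blast+
      have "u \<otimes> inv v = x \<otimes> inv y"
        using c g by (simp add: xy inv_mult_group m_assoc inv_mult_cancel)
      then show ?thesis using Suc.prems(2) xy by simp
    qed
    ultimately have "card Y \<le> 2 ^ m" by (rule Suc.IH)
    moreover have "inj_on (\<lambda>y. y \<otimes> inv g n) X"
      using Suc.prems(1) P_closed g by (intro inj_onI) (metis inv_closed right_cancel subsetD)
    ultimately show ?thesis by (simp add: Y_def card_image)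
  qed
qed

section \<open>Infinite divisibility\<close>

text \<open>This will make the translates of the tail set disjoint. By \<open>mult_g_neq\<close>,
  both sides end in \<open>g (m + n)\<close> or neither does; cancelling it reduces to
  \<open>s = t = \<one>\<close>.\<close>

lemma prefix_unique:
  assumes "p \<in> P m" "q \<in> P m" "s \<in> subproducts G g m n" "t \<in> subproducts G g m n"
    and "p \<otimes> s = q \<otimes> t"
  shows "p = q"
  using assms(3-)
proof (induction n arbitrary: s t)
  case 0
  then show ?case using assms(1,2) P_closed by auto
next
  case (Suc n)
  have c: "p \<in> carrier G" "q \<in> carrier G" using assms P_closed by auto
  have T: "r \<otimes> u \<in> P (m + n)" "u \<in> carrier G"
    if "r \<in> P m" "u \<in> subproducts G g m n" for r u
    using that subproducts_add[of g m n] subproducts_closed[of g m n] g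
    by (auto simp: l_coset_def)
  have neq: "r \<otimes> (u \<otimes> g (m + n)) \<noteq> r' \<otimes> v"
    if "r \<in> P m" "r' \<in> P m" "u \<in> subproducts G g m n" "v \<in> subproducts G g m n" for r r' u v
    using mult_g_neq[OF T(1)[OF that(1,3)] T(1)[OF that(2,4)]] that T(2) P_closed g
    by (simp add: m_assoc)
  consider "s \<in> subproducts G g m n" "t \<in> subproducts G g m n"
    | u v where "u \<in> subproducts G g m n" "v \<in> subproducts G g m n"
        "s = u \<otimes> g (m + n)" "t = v \<otimes> g (m + n)"
    | u where "u \<in> subproducts G g m n" "s = u \<otimes> g (m + n)" "t \<in> subproducts G g m n"
    | v where "v \<in> subproducts G g m n" "t = v \<otimes> g (m + n)" "s \<in> subproducts G g m n"
    using Suc.prems(1,2) by (auto simp: r_coset_def)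
  then show ?case
  proof cases
    case 1
    then show ?thesis using Suc by blast
  next
    case 2
    then have "p \<otimes> u \<otimes> g (m + n) = q \<otimes> v \<otimes> g (m + n)"
      using Suc.prems(3) c T(2)[OF assms(1)] g by (simp add: m_assoc)
    then have "p \<otimes> u = q \<otimes> v"
      using c T(2)[OF assms(1)] 2 g by simp
    then show ?thesis using Suc.IH 2 by blast
  next
    case 3
    then show ?thesis using neq[OF assms(1,2)] Suc.prems(3) by simp
  next
    case 4
    then show ?thesis using neq[OF assms(2,1)] Suc.prems(3) by metis
  qed
qed

lemma infinitely_divisible_subproducts: "infinitely_divisible G (\<Union>n. P n)"
  unfolding infinitely_divisible_def
proof (intro allI impI)
  fix m :: nat
  define A where "A = (\<Union>n. P n)"
  define T where "T = (\<Union>n. subproducts G g m n)"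
  have A: "A \<subseteq> carrier G" "\<one> \<in> A"
    using P_closed by (auto simp: A_def intro: one_in_subproducts)
  have T: "T \<subseteq> carrier G" "\<one> \<in> T"
    using subproducts_closed[of g] g by (auto simp: T_def intro: one_in_subproducts)
  have A_eq: "A = (\<Union>p\<in>P m. p <# T)"
  proof -
    have "P n \<subseteq> P (m + n)" for n by (rule subproducts_mono) simp
    then have "A = (\<Union>n. P (m + n))" unfolding A_def by blast
    also have "\<dots> = (\<Union>p\<in>P m. p <# T)"
      unfolding subproducts_add[of g m, OF g] T_def l_coset_def by blast
    finally show ?thesis .
  qed
  have equiv: "set_equivalent G (p <# T) A" if p: "p \<in> P m" for p
  proof -
    have pc: "p \<in> carrier G" using p P_closed by blast
    have sub: "p <# T \<subseteq> A" using p A_eq by blast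
    have ne: "p <# T \<noteq> {}" using T by (auto simp: l_coset_def)
    have "p <# T \<subseteq> (\<Union>x\<in>{\<one>}. x <# A)"
      using sub A lcos_mult_one[of A] by simp
    \<comment> \<open>Left multiplication by \<open>q \<otimes> inv p\<close> carries the piece with
      prefix \<open>p\<close> onto the piece with prefix \<open>q\<close>.\<close>
    moreover have "A \<subseteq> (\<Union>x\<in>(\<lambda>q. q \<otimes> inv p) ` P m. x <# (p <# T))"
    proof
      fix a assume "a \<in> A"
      then obtain q where q: "q \<in> P m" "a \<in> q <# T" using A_eq by blast
      have "(q \<otimes> inv p) <# (p <# T) = q <# T"
        using q(1) P_closed pc T by (simp add: lcos_m_assoc m_assoc)
      then show "a \<in> (\<Union>x\<in>(\<lambda>q. q \<otimes> inv p) ` P m. x <# (p <# T))" using q by auto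
    qed
    moreover have "finite ((\<lambda>q. q \<otimes> inv p) ` P m)" "(\<lambda>q. q \<otimes> inv p) ` P m \<subseteq> carrier G"
      using P_closed pc by (auto intro: finite_subproducts)
    ultimately have "\<exists>F. finite F \<and> F \<subseteq> carrier G \<and> p <# T \<subseteq> (\<Union>x\<in>F. x <# A)"
      and "\<exists>F. finite F \<and> F \<subseteq> carrier G \<and> A \<subseteq> (\<Union>x\<in>F. x <# (p <# T))"
      by (meson empty_subsetI finite.emptyI finite_insert insert_subset one_closed)+
    then show ?thesis
      using A sub ne unfolding set_equivalent_def set_below_def by blast
  qed
  \<comment> \<open>Since \<open>m < 2 ^ m\<close>, there are enough prefixes to choose
    \<open>m\<close> distinct ones.\<close>
  have "card {1..m} \<le> card (P m)" by (simp add: card_subproducts less_imp_le)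
  then obtain f where f: "f ` {1..m} \<subseteq> P m" "inj_on f {1..m}"
    using card_le_inj[of "{1..m}" "P m"] finite_subproducts by blast
  have "disjoint_family_on (\<lambda>j. f j <# T) {1..m}"
    unfolding disjoint_family_on_def
  proof (intro ballI impI, rule ccontr)
    fix i j assume ij: "i \<in> {1..m}" "j \<in> {1..m}" "i \<noteq> j"
      and "(f i <# T) \<inter> (f j <# T) \<noteq> {}"
    then obtain k l s t where st: "s \<in> subproducts G g m k" "t \<in> subproducts G g m l"
      "f i \<otimes> s = f j \<otimes> t" by (auto simp: T_def l_coset_def)
    \<comment> \<open>The two tails may come from windows of different length;
      \<open>prefix_unique\<close> needs a common one.\<close>
    have "s \<in> subproducts G g m (max k l)" "t \<in> subproducts G g m (max k l)"
      using st subproducts_mono[of _ "max k l" G g m] by (meson max.cobounded1 max.cobounded2 subsetD)+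
    then have "f i = f j" using prefix_unique st(3) f(1) ij by blast
    then show False using f(2) ij by (auto dest: inj_onD)
  qed
  moreover have "f j <# T \<subseteq> A \<and> set_equivalent G (f j <# T) A" if "j \<in> {1..m}" for j
    using that f(1) equiv A_eq by blast
  ultimately show "n_divisible G m (\<Union>n. P n)"
    using A unfolding n_divisible_def A_def by (intro conjI exI[of _ "\<lambda>j. f j <# T"]) auto
qed

section \<open>Translates of finite sets and the choice of \<open>U\<close>\<close>

text \<open>Writing \<open>k \<otimes> x = f k \<otimes> a k\<close>, the pair
  \<open>(f k, a k)\<close> determines \<open>k\<close>, so \<open>a\<close> takes at least
  \<open>card K / card F\<close> values. Their quotients lie in \<open>U m\<close>, which allows at
  most \<open>2 ^ m\<close> values.\<close>

lemma translate_not_subset: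
  assumes F: "finite F" "F \<subseteq> carrier G" and K: "finite K" "K \<subseteq> carrier G"
    and large: "card F * 2 ^ m < card K"
    and quot: "\<And>e f k l. e \<in> F \<Longrightarrow> f \<in> F \<Longrightarrow> k \<in> K \<Longrightarrow> l \<in> K \<Longrightarrow>
      inv e \<otimes> k \<otimes> inv l \<otimes> f \<in> U m"
    and x: "x \<in> carrier G"
  shows "\<not> K #> x \<subseteq> (\<Union>f\<in>F. f <# (\<Union>n. P n))"
proof
  assume "K #> x \<subseteq> (\<Union>f\<in>F. f <# (\<Union>n. P n))"
  then have "\<forall>k\<in>K. \<exists>f\<in>F. \<exists>a\<in>(\<Union>n. P n). k \<otimes> x = f \<otimes> a"
    by (fastforce simp: r_coset_def l_coset_def)
  then obtain f a where fa: "\<And>k. k \<in> K \<Longrightarrow> f k \<in> F" "\<And>k. k \<in> K \<Longrightarrow> a k \<in> (\<Union>n. P n)"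
    "\<And>k. k \<in> K \<Longrightarrow> k \<otimes> x = f k \<otimes> a k"
    by metis
  have c: "f k \<in> carrier G" "a k \<in> carrier G" "k \<in> carrier G" if "k \<in> K" for k
    using that fa F K P_closed by blast+
  have "\<exists>n. a ` K \<subseteq> P n"
  proof -
    have "\<forall>k\<in>K. \<exists>n. a k \<in> P n" using fa by blast
    then obtain h where h: "\<And>k. k \<in> K \<Longrightarrow> a k \<in> P (h k)" by metis
    have "a k \<in> P (Max (h ` K))" if "k \<in> K" for k
      using h[OF that] subproducts_mono[of "h k" "Max (h ` K)" G g 0] K that by auto
    then show ?thesis by blast
  qed
  then obtain n where n: "a ` K \<subseteq> P n" by blast
  have "card (a ` K) \<le> 2 ^ m"
  proof (rule card_le_if_quotients[OF n])
    fix y z assume "y \<in> a ` K" "z \<in> a ` K"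
    then obtain k l where kl: "k \<in> K" "l \<in> K" "y = a k" "z = a l" by blast
    have a: "a k = inv f k \<otimes> k \<otimes> x" if "k \<in> K" for k
      using c[OF that] x fa(3)[OF that] by (simp add: inv_solve_left m_assoc)
    \<comment> \<open>The unknown \<open>x\<close> cancels, so the quotients are controlled by
      \<open>F\<close> and \<open>K\<close> alone.\<close>
    have "y \<otimes> inv z = inv f k \<otimes> k \<otimes> inv l \<otimes> f l"
      using c[OF kl(1)] c[OF kl(2)] x
      by (simp add: kl(3,4) a[OF kl(1)] a[OF kl(2)] inv_mult_group m_assoc inv_mult_cancel)
    also have "\<dots> \<in> U m" using quot fa kl by blast
    finally show "y \<otimes> inv z \<in> U m" .
  qed
  moreover have "card K \<le> card (F \<times> a ` K)"
  proof (rule card_inj_on_le)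
    show "inj_on (\<lambda>k. (f k, a k)) K"
      using fa(3) c x by (intro inj_onI) (metis prod.inject right_cancel)
  qed (use fa F K in auto)
  ultimately have "card K \<le> card F * 2 ^ m"
    by (simp add: card_cartesian_product) (meson le_trans mult_le_mono2)
  with large show False by simp
qed

end

text \<open>\<open>U\<close> has to be fixed before \<open>g\<close>, hence must serve every
  \<open>F\<close> at once. By countability each finite \<open>F\<close> lies in some initial
  segment \<open>E r\<close> of an enumeration, and \<open>U n\<close> collects the quotients for
  all \<open>r \<le> n\<close>.\<close>

lemma exists_quotient_bounds:
  assumes "countable (carrier G)" and inf: "infinite (carrier G)"
  obtains U :: "nat \<Rightarrow> 'a set" where "\<And>n. finite (U n)" "\<And>n. \<one> \<in> U n" "mono U"
    "\<And>F. finite F \<Longrightarrow> F \<subseteq> carrier G \<Longrightarrow> \<exists>m K. finite K \<and> K \<subseteq> carrier G \<and>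
       card F * 2 ^ m < card K \<and>
       (\<forall>e\<in>F. \<forall>f\<in>F. \<forall>k\<in>K. \<forall>l\<in>K. inv e \<otimes> k \<otimes> inv l \<otimes> f \<in> U m)"
proof -
  define E where "E r = from_nat_into (carrier G) ` {..<r}" for r
  have E: "finite (E r)" "card (E r) \<le> r" for r
    using card_image_le[of "{..<r}"] by (auto simp: E_def)
  \<comment> \<open>The size just exceeds \<open>card F * 2 ^ m\<close> for
    \<open>card F \<le> r\<close> and \<open>m = r\<close>.\<close>
  have "\<forall>r. \<exists>K. K \<subseteq> carrier G \<and> finite K \<and> card K = Suc (r * 2 ^ r)"
    using inf infinite_arbitrarily_large by blast
  then obtain K where K: "K r \<subseteq> carrier G" "finite (K r)" "card (K r) = Suc (r * 2 ^ r)" for r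
    by metis
  define V where "V r = (\<lambda>(e, k, l, f). inv e \<otimes> k \<otimes> inv l \<otimes> f) ` (E r \<times> K r \<times> K r \<times> E r)" for r
  define U where "U n = insert \<one> (\<Union>r\<le>n. V r)" for n
  show thesis
  proof (rule that[of U])
    show "finite (U n)" for n using E K by (auto simp: U_def V_def)
    show "\<one> \<in> U n" for n by (simp add: U_def)
    show "mono U" unfolding U_def by (intro monoI insert_mono UN_mono) auto
    fix F assume F: "finite F" "F \<subseteq> carrier G"
    have "\<forall>x\<in>F. \<exists>i. x = from_nat_into (carrier G) i"
      using F assms by (metis from_nat_into_surj subsetD)
    then obtain h where h: "\<And>x. x \<in> F \<Longrightarrow> x = from_nat_into (carrier G) (h x)" by metis
    \<comment> \<open>For empty \<open>F\<close> the maximum is unspecified, but then any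
      \<open>r\<close> works.\<close>
    define r where "r = Suc (Max (h ` F))"
    have FE: "F \<subseteq> E r"
      using h F by (auto simp: E_def r_def less_Suc_eq_le intro!: image_eqI)
    have "card F \<le> r" using card_mono[OF E(1) FE] E(2)[of r] by simp
    then have "card F * 2 ^ r < card (K r)" using K(3)[of r] by (simp add: less_Suc_eq_le)
    moreover have "inv e \<otimes> k \<otimes> inv l \<otimes> f \<in> U r"
      if "e \<in> F" "f \<in> F" "k \<in> K r" "l \<in> K r" for e f k l
    proof -
      have "inv e \<otimes> k \<otimes> inv l \<otimes> f \<in> V r"
        unfolding V_def using that FE by (intro image_eqI[of _ _ "(e, k, l, f)"]) auto
      then show ?thesis by (auto simp: U_def)
    qed
    ultimately show "\<exists>m K. finite K \<and> K \<subseteq> carrier G \<and> card F * 2 ^ m < card K \<and>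
       (\<forall>e\<in>F. \<forall>f\<in>F. \<forall>k\<in>K. \<forall>l\<in>K. inv e \<otimes> k \<otimes> inv l \<otimes> f \<in> U m)"
      using K(1,2) by (intro exI[of _ r] exI[of _ "K r"] conjI ballI) auto
  qed
qed

end

theorem theorem8p2:
  fixes G (structure)
  assumes "group G"
    and "countable (carrier G)"
    and "infinite (carrier G)"
  shows "\<exists>A. infinitely_divisible G A \<and> \<not> (\<exists>B. absorbing G B \<and> set_equivalent G A B)"
proof -
  interpret group G by fact
  obtain U where U: "\<And>n. finite (U n)" "\<And>n. \<one> \<in> U n" "mono U"
    "\<And>F. finite F \<Longrightarrow> F \<subseteq> carrier G \<Longrightarrow> \<exists>m K. finite K \<and> K \<subseteq> carrier G \<and>
       card F * 2 ^ m < card K \<and>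
       (\<forall>e\<in>F. \<forall>f\<in>F. \<forall>k\<in>K. \<forall>l\<in>K. inv e \<otimes> k \<otimes> inv l \<otimes> f \<in> U m)"
    using exists_quotient_bounds[OF assms(2,3)] by metis
  obtain g where g: "\<And>i. g i \<in> carrier G" "separated U g"
    using exists_separated[OF assms(3)] U(1) by metis
  define A where "A = (\<Union>n. subproducts G g 0 n)"
  have "\<not> set_equivalent G A B" if B: "absorbing G B" for B
  proof
    assume "set_equivalent G A B"
    then obtain F where F: "finite F" "F \<subseteq> carrier G" "B \<subseteq> (\<Union>f\<in>F. f <# A)"
      unfolding set_equivalent_def set_below_def by blast
    \<comment> \<open>\<open>K\<close> depends only on \<open>F\<close>; absorption then puts a
      right translate of it into \<open>B\<close>, hence into \<open>F A\<close>.\<close>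
    obtain m K where K: "finite K" "K \<subseteq> carrier G" "card F * 2 ^ m < card K"
      "\<forall>e\<in>F. \<forall>f\<in>F. \<forall>k\<in>K. \<forall>l\<in>K. inv e \<otimes> k \<otimes> inv l \<otimes> f \<in> U m"
      using U(4)[OF F(1,2)] by blast
    obtain x where x: "x \<in> carrier G" "K #> x \<subseteq> B"
      using B K(1,2) unfolding absorbing_def by blast
    have "\<not> K #> x \<subseteq> (\<Union>f\<in>F. f <# A)"
      unfolding A_def
      by (rule translate_not_subset[OF g U(2,3) F(1,2) K(1-3) _ x(1)]) (use K(4) in blast)
    then show False using x(2) F(3) by blast
  qed
  moreover have "infinitely_divisible G A"
    unfolding A_def by (rule infinitely_divisible_subproducts[OF g U(2,3)])
  ultimately show ?thesis by blast
qed

end
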